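(* Let $j\in\mathbb N$. For all integers $1\le p,\ell\le j$ there is a constant $c_{p,\ell}\in\mathbb C$, depending only on $j$, $p$, and $\ell$, such that for every $\gamma\in\mathbb R$ and every $k\in\mathbb C$ with $k\ne i\gamma$, $$(-1)^{j+1}\left(\mathfrak b_\ell(k)-\sum_{n=1}^{j+1}\mathcal P_{p,n}(k)\,\mathfrak b_\ell(\alpha_{p,n}k)\right)=c_{p,\ell}\,\frac{k^{2j+1-\ell}}{k-i\gamma}.$$
   Context: $\omega=e^{2\pi i/(2j+1)}$; for $1\le p\le j$, $1\le n\le j+1$: $\alpha_{p,n}=\omega^{j-p+n}$, $Q_p(z)=\prod_{m=1}^{j+1}(z-\alpha_{p,m})$, $L_{p,n}(z)=\prod_{1\le m\le j+1,\,m\ne n}\frac{z-\alpha_{p,m}}{\alpha_{p,n}-\alpha_{p,m}}$, and $$\mathcal P_{p,n}(k)=L_{p,n}(1)-\frac{Q_p(1)}{Q_p'(\alpha_{p,n})}\frac{k}{k-i\gamma}.$$ For $1\le\ell\le j$, $\mathfrak b_\ell(k)=\sum_{q=\ell}^j(ik)^{2j-q}(-\gamma)^{q-\ell}$ (with the convention $0^0=1$). *)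

theory Defs
  imports "HOL-Analysis.Analysis"
begin

definition omega :: "nat \<Rightarrow> complex" where
  "omega j = exp (2 * of_real pi * \<i> / of_nat (2 * j + 1))"

(* Only used for p \<le> j, so the subtraction on nat does not truncate. *)
definition alpha :: "nat \<Rightarrow> nat \<Rightarrow> nat \<Rightarrow> complex" where
  "alpha j p n = omega j ^ (j - p + n)"

definition Qp :: "nat \<Rightarrow> nat \<Rightarrow> complex \<Rightarrow> complex" where
  "Qp j p z = (\<Prod>m=1..j+1. z - alpha j p m)"

definition Lp :: "nat \<Rightarrow> nat \<Rightarrow> nat \<Rightarrow> complex \<Rightarrow> complex" where
  "Lp j p n z = (\<Prod>m\<in>{1..j+1} - {n}. (z - alpha j p m) / (alpha j p n - alpha j p m))"

definition Pcal :: "nat \<Rightarrow> real \<Rightarrow> nat \<Rightarrow> nat \<Rightarrow> complex \<Rightarrow> complex" where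
  "Pcal j \<gamma> p n k =
     Lp j p n 1 - Qp j p 1 / deriv (Qp j p) (alpha j p n) * (k / (k - \<i> * of_real \<gamma>))"

(* The natural-number exponents do not truncate for l \<le> q \<le> j, and x ^ 0 = 1 holds
   in particular for x = 0. *)
definition bfrak :: "nat \<Rightarrow> real \<Rightarrow> nat \<Rightarrow> complex \<Rightarrow> complex" where
  "bfrak j \<gamma> l k = (\<Sum>q=l..j. (\<i> * k) ^ (2 * j - q) * (- of_real \<gamma>) ^ (q - l))"

end

theory Submission
  imports Defs "HOL-Computational_Algebra.Polynomial"
begin

text \<open>
  Write \<open>U\<^sub>d = 1 - (\<Sum>n. L\<^sub>n(1) \<alpha>\<^sub>n\<^sup>d)\<close> for the error that is made at the point 1 when
  \<open>z\<^sup>d\<close> is replaced by its Lagrange interpolant at the nodes \<open>\<alpha>\<^sub>n\<close> (the index \<open>p\<close> is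
  dropped). The proof rests on two properties of these numbers.

  First, \<open>Q(1) / Q'(\<alpha>\<^sub>n) = (1 - \<alpha>\<^sub>n) L\<^sub>n(1)\<close> (lemma \<open>Qp_over_deriv\<close>). Hence the terms with
  \<open>Q'\<close> bring in no new quantities: \<open>\<Sum>n. Q(1) / Q'(\<alpha>\<^sub>n) \<alpha>\<^sub>n\<^sup>d = U\<^bsub>d+1\<^esub> - U\<^sub>d\<close>. With \<open>d = 2j - q\<close>, the
  summand \<open>(\<i>k)\<^sup>d (-\<gamma>)\<^bsup>q-l\<^esup>\<close> of \<open>bfrak\<close> therefore contributes
  \<open>(\<i>k)\<^sup>d (-\<gamma>)\<^bsup>q-l\<^esup> (k U\<^bsub>d+1\<^esub> - \<i>\<gamma> U\<^sub>d) / (k - \<i>\<gamma>)\<close>,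
  which is \<open>\<i> (T\<^bsub>q+1\<^esub> - T\<^sub>q) / (k - \<i>\<gamma>)\<close> for \<open>T\<^sub>q = (\<i>k)\<^bsup>2j+1-q\<^esup> (-\<gamma>)\<^bsup>q-l\<^esup> U\<^bsub>2j+1-q\<^esub>\<close>.
  So the sum over \<open>q\<close> telescopes to its two boundary terms.

  Second, the upper boundary term contains the factor \<open>U\<^sub>j\<close>, and \<open>U\<^sub>j = 0\<close>, because
  interpolation at \<open>j + 1\<close> distinct nodes is exact in degree \<open>j\<close> (lemmas
  \<open>lagrange_interpolation\<close> and \<open>inj_on_alpha\<close>). The lower boundary term \<open>T\<^sub>l\<close> does not
  contain \<open>\<gamma>\<close>; it is a constant multiple of \<open>k\<^bsup>2j+1-l\<^esup>\<close>.
\<close>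

lemma lagrange_interpolation:
  fixes x :: "'i \<Rightarrow> 'a :: field" and f :: "'a poly"
  assumes fin: "finite I" and inj: "inj_on x I" and deg: "degree f < card I"
  shows "(\<Sum>i\<in>I. (\<Prod>m\<in>I - {i}. (z - x m) / (x i - x m)) * poly f (x i)) = poly f z"
proof -
  define b where "b i = (\<Prod>m\<in>I - {i}. smult (inverse (x i - x m)) [:- x m, 1:])" for i
  define g where "g = (\<Sum>i\<in>I. smult (poly f (x i)) (b i))"
  have poly_b: "poly (b i) y = (\<Prod>m\<in>I - {i}. (y - x m) / (x i - x m))" for i y
    unfolding b_def poly_prod by (intro prod.cong refl) (simp add: divide_inverse algebra_simps)
  have poly_g: "poly g y = (\<Sum>i\<in>I. (\<Prod>m\<in>I - {i}. (y - x m) / (x i - x m)) * poly f (x i))" for y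
    unfolding g_def poly_sum by (intro sum.cong refl) (simp add: poly_b mult.commute)
  have node: "poly (b i) (x i') = (if i = i' then 1 else 0)" if "i \<in> I" "i' \<in> I" for i i'
  proof (cases "i = i'")
    case True
    have "(x i - x m) / (x i - x m) = 1" if "m \<in> I - {i}" for m
      using that \<open>i \<in> I\<close> inj by (auto simp: inj_on_def)
    then show ?thesis using True by (simp add: poly_b)
  next
    case False
    then show ?thesis using that fin by (auto simp: poly_b intro!: prod_zero)
  qed
  have "poly g (x i') = poly f (x i')" if "i' \<in> I" for i'
  proof -
    have "poly g (x i') = (\<Sum>i\<in>I. if i = i' then poly f (x i) else 0)"
      unfolding g_def poly_sum using that by (intro sum.cong refl) (simp add: node)
    then show ?thesis using fin that by simp
  qed
  moreover have "degree (b i) < card I" if "i \<in> I" for i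
  proof -
    have "degree (b i) \<le> (\<Sum>m\<in>I - {i}. 1)"
      unfolding b_def
      by (rule order.trans[OF degree_prod_sum_le sum_mono]) (use fin in auto)
    also have "\<dots> < card I"
      using fin that by (simp add: card_Diff1_less del: card_Diff_insert card_Diff_singleton)
    finally show ?thesis .
  qed
  then have "degree g < card I"
    unfolding g_def using fin deg
    by (intro degree_sum_less) (auto intro: le_less_trans[OF degree_smult_le])
  ultimately have "g = f"
    using deg inj
    by (intro poly_eqI_degree[of "x ` I"]) (auto simp: card_image)
  then show ?thesis using poly_g[of z] by simp
qed

text \<open>
  The exponents in the \<open>\<alpha>\<^sub>n\<close> lie between 1 and \<open>2j\<close>, so distinct indices give exponents that
  are incongruent modulo the order \<open>2j + 1\<close> of \<open>\<omega>\<close>.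
\<close>

lemma inj_on_alpha: "inj_on (alpha j p) {1..j+1}" if "1 \<le> p" "p \<le> j"
proof (rule inj_onI)
  fix m n assume mn: "m \<in> {1..j+1}" "n \<in> {1..j+1}" and eq: "alpha j p m = alpha j p n"
  have pw: "omega j ^ a = exp (2 * of_real pi * \<i> * of_nat a / of_nat (2 * j + 1))" for a
    unfolding omega_def exp_of_nat_mult[symmetric] by (simp add: field_simps)
  have "(j - p + m) mod (2 * j + 1) = (j - p + n) mod (2 * j + 1)"
    using eq unfolding alpha_def pw
    by (subst (asm) complex_root_unity_eq) (auto simp: cong_def)
  moreover have "j - p + m < 2 * j + 1" "j - p + n < 2 * j + 1" using mn that by auto
  ultimately show "m = n" by (simp only: mod_less add_left_cancel)
qed

lemma deriv_Qp_alpha: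
  assumes "n \<in> {1..j+1}"
  shows "deriv (Qp j p) (alpha j p n) = (\<Prod>m\<in>{1..j+1} - {n}. alpha j p n - alpha j p m)"
proof (rule DERIV_imp_deriv)
  define R where "R z = (\<Prod>m\<in>{1..j+1} - {n}. z - alpha j p m)" for z
  have Q: "Qp j p = (\<lambda>z. (z - alpha j p n) * R z)"
    unfolding Qp_def R_def by (rule ext) (rule prod.remove, use assms in auto)
  obtain D where D: "(R has_field_derivative D) (at (alpha j p n))"
  proof
    show "(R has_field_derivative
        (\<Sum>m\<in>{1..j+1} - {n}. 1 * (\<Prod>i\<in>{1..j+1} - {n} - {m}. alpha j p n - alpha j p i)))
        (at (alpha j p n))"
      unfolding R_def
      by (rule has_field_derivative_prod) (auto intro!: derivative_eq_intros)
  qed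
  have "((\<lambda>z. (z - alpha j p n) * R z) has_field_derivative R (alpha j p n)) (at (alpha j p n))"
    by (rule derivative_eq_intros D refl | simp)+
  then show "(Qp j p has_field_derivative (\<Prod>m\<in>{1..j+1} - {n}. alpha j p n - alpha j p m)) (at (alpha j p n))"
    unfolding Q R_def .
qed

text \<open>
  By this identity the two families of coefficients in \<open>Pcal\<close> are multiples of each other,
  with a factor linear in the node; multiplying by the node raises the degree of a
  monomial by one, so the sums over the nodes become differences of consecutive moments.
\<close>

lemma Qp_over_deriv:
  assumes "n \<in> {1..j+1}"
  shows "Qp j p z / deriv (Qp j p) (alpha j p n) = (z - alpha j p n) * Lp j p n z"
proof -
  have "Qp j p z = (z - alpha j p n) * (\<Prod>m\<in>{1..j+1} - {n}. z - alpha j p m)"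
    unfolding Qp_def by (rule prod.remove) (use assms in auto)
  then show ?thesis
    unfolding deriv_Qp_alpha[OF assms] Lp_def by (simp add: prod_dividef)
qed

theorem lemma3p3:
  fixes j p l :: nat
  assumes "1 \<le> p" "p \<le> j" "1 \<le> l" "l \<le> j"
  shows "\<exists>c::complex. \<forall>(\<gamma>::real) (k::complex). k \<noteq> \<i> * of_real \<gamma> \<longrightarrow>
    (-1) ^ (j + 1) * (bfrak j \<gamma> l k - (\<Sum>n=1..j+1. Pcal j \<gamma> p n k * bfrak j \<gamma> l (alpha j p n * k)))
      = c * (k ^ (2 * j + 1 - l) / (k - \<i> * of_real \<gamma>))"
proof -
  define S where "S d = (\<Sum>n=1..j+1. Lp j p n 1 * alpha j p n ^ d)" for d
  \<comment> \<open>In the notation of the introduction, \<open>S d = 1 - U\<^sub>d\<close>.\<close>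
  have S_j: "S j = 1"
  proof -
    have "S j = poly (monom 1 j) 1"
      unfolding S_def Lp_def poly_monom
      using lagrange_interpolation[OF _ inj_on_alpha[OF assms(1,2)], of "monom 1 j" 1]
      by (simp add: poly_monom degree_monom_eq)
    then show ?thesis by (simp add: poly_monom)
  qed
  show ?thesis
  proof (intro exI allI impI)
    fix \<gamma> :: real and k :: complex
    assume k: "k \<noteq> \<i> * of_real \<gamma>"
    define D where "D = k - \<i> * of_real \<gamma>"
    have D: "D \<noteq> 0" using k by (simp add: D_def)
    define a where "a q = (\<i> * k) ^ (2 * j - q) * (- of_real \<gamma>) ^ (q - l)" for q
    define T where "T q = (\<i> * k) ^ (2 * j + 1 - q) * (- of_real \<gamma>) ^ (q - l) * (1 - S (2 * j + 1 - q))" for q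
    have P: "Pcal j \<gamma> p n k = Lp j p n 1 * (1 - (1 - alpha j p n) * (k / D))" if "n \<in> {1..j+1}" for n
      unfolding Pcal_def Qp_over_deriv[OF that] D_def[symmetric] by (simp add: algebra_simps)
    have b: "bfrak j \<gamma> l (y * k) = (\<Sum>q=l..j. a q * y ^ (2 * j - q))" for y
      unfolding bfrak_def a_def
      by (intro sum.cong refl) (simp add: power_mult_distrib algebra_simps)
    have moments: "(\<Sum>n=1..j+1. Lp j p n 1 * (1 - (1 - alpha j p n) * (k / D)) * alpha j p n ^ d)
        = S d - (S d - S (Suc d)) * (k / D)" for d
      unfolding S_def sum_subtractf[symmetric] sum_distrib_right
      by (intro sum.cong refl) (simp add: algebra_simps)
    have "(\<Sum>n=1..j+1. Pcal j \<gamma> p n k * bfrak j \<gamma> l (alpha j p n * k))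
        = (\<Sum>n=1..j+1. \<Sum>q=l..j. a q * (Lp j p n 1 * (1 - (1 - alpha j p n) * (k / D)) * alpha j p n ^ (2 * j - q)))"
      by (intro sum.cong refl) (simp only: P b, simp only: sum_distrib_left mult_ac)
    also have "\<dots> = (\<Sum>q=l..j. a q * (S (2 * j - q) - (S (2 * j - q) - S (Suc (2 * j - q))) * (k / D)))"
      by (subst sum.swap) (simp only: sum_distrib_left[symmetric] moments)
    finally have "D * (bfrak j \<gamma> l k - (\<Sum>n=1..j+1. Pcal j \<gamma> p n k * bfrak j \<gamma> l (alpha j p n * k)))
        = (\<Sum>q=l..j. D * a q - D * (a q * (S (2 * j - q) - (S (2 * j - q) - S (Suc (2 * j - q))) * (k / D))))"
      using b[of 1] by (simp add: right_diff_distrib sum_distrib_left sum_subtractf)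
    \<comment> \<open>The factor \<open>\<i>\<close> turns \<open>k\<close> into \<open>-\<i> (\<i>k)\<close> and \<open>-\<i>\<gamma>\<close> into \<open>\<i> (-\<gamma>)\<close>: the first shifts the
      power of \<open>\<i>k\<close> to that of \<open>T q\<close>, the second the power of \<open>-\<gamma>\<close> to that of \<open>T (Suc q)\<close>.\<close>
    also have "\<dots> = (\<Sum>q=l..j. \<i> * T (Suc q) - \<i> * T q)"
    proof (intro sum.cong refl)
      fix q assume q: "q \<in> {l..j}"
      have e: "2 * j + 1 - q = Suc (2 * j - q)" "2 * j + 1 - Suc q = 2 * j - q" "Suc q - l = Suc (q - l)"
        using q by auto
      have "D * a q - D * (a q * (S (2 * j - q) - (S (2 * j - q) - S (Suc (2 * j - q))) * (k / D)))
          = a q * (D * (1 - S (2 * j - q)) + (S (2 * j - q) - S (Suc (2 * j - q))) * k)"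
        using D by (simp add: field_simps)
      also have "\<dots> = a q * (k * (1 - S (Suc (2 * j - q))) - \<i> * of_real \<gamma> * (1 - S (2 * j - q)))"
        by (simp add: D_def algebra_simps)
      also have "\<dots> = \<i> * T (Suc q) - \<i> * T q"
        unfolding T_def e a_def by (simp add: algebra_simps)
      finally show "D * a q - D * (a q * (S (2 * j - q) - (S (2 * j - q) - S (Suc (2 * j - q))) * (k / D)))
          = \<i> * T (Suc q) - \<i> * T q" .
    qed
    also have "\<dots> = \<i> * T (Suc j) - \<i> * T l"
      using assms by (intro sum_Suc_diff) simp
    also have "T (Suc j) = 0"
      by (simp add: T_def S_j)
    finally have "bfrak j \<gamma> l k - (\<Sum>n=1..j+1. Pcal j \<gamma> p n k * bfrak j \<gamma> l (alpha j p n * k))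
        = - \<i> * T l / D"
      using D by (simp add: field_simps)
    then show "(-1) ^ (j + 1) * (bfrak j \<gamma> l k - (\<Sum>n=1..j+1. Pcal j \<gamma> p n k * bfrak j \<gamma> l (alpha j p n * k)))
      = ((-1) ^ (j + 1) * (- \<i> * \<i> ^ (2 * j + 1 - l) * (1 - S (2 * j + 1 - l))))
        * (k ^ (2 * j + 1 - l) / (k - \<i> * of_real \<gamma>))"
      by (simp add: T_def D_def power_mult_distrib)
  qed
qed

end
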